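(* For any positive integers $n$ and $r$ with $r\leq n$, there exists an $n$-vertex directed graph with a source $s$, a sink $t$, and $(s,t)$-max-flow value $2r$, such that any dual fault-tolerant min-cut oracle for this graph requires $\Omega(nr)$ bits.
   Context: Graphs are directed unweighted with unit edge capacities. A dual fault-tolerant min-cut oracle for a graph $G$ is a data structure that, given any set $F$ of two edges of $G$, reports the size of an $(s,t)$-min-cut in $G-F$ (the graph with the edges of $F$ deleted).
   Formalization: The case n = 1 is excluded (no distinct source and sink), parallel edges are allowed (needed when r is close to n), and the oracle's query procedure is fixed before the graph is chosen, since for one fixed graph the answers could be built into the procedure at 0 bits. *)

theory Defs
  imports Complex_Main "Graph_Theory.Digraph"
begin

text \<open>
  Parallel edges are allowed: a max-flow value \<open>2 r\<close> with \<open>r\<close> as large as the number of vertices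
  is impossible in a simple graph. An edge \<open>(u, v, k)\<close> goes from \<open>u\<close> to \<open>v\<close>; the index \<open>k\<close> only
  separates parallel edges. So the name of an edge already reveals its endpoints, and the vertices
  are always \<open>0, \<dots>, n - 1\<close>: an oracle does not have to spend bits on decoding arbitrary names.
\<close>

type_synonym edge = "nat \<times> nat \<times> nat"

definition n_vertex_digraph :: "nat \<Rightarrow> (nat, edge) pre_digraph \<Rightarrow> bool" where
  "n_vertex_digraph n G \<longleftrightarrow>
     fin_digraph G \<and> verts G = {..<n} \<and>
     (\<forall>u v k. tail G (u, v, k) = u \<and> head G (u, v, k) = v)"

definition delete_arcs :: "('a, 'b) pre_digraph \<Rightarrow> 'b set \<Rightarrow> ('a, 'b) pre_digraph" where
  "delete_arcs G F = G\<lparr>arcs := arcs G - F\<rparr>"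


definition is_flow :: "('a, 'b) pre_digraph \<Rightarrow> 'a \<Rightarrow> 'a \<Rightarrow> ('b \<Rightarrow> real) \<Rightarrow> bool" where
  "is_flow G s t f \<longleftrightarrow>
     (\<forall>e \<in> arcs G. 0 \<le> f e \<and> f e \<le> 1) \<and>
     (\<forall>v \<in> verts G - {s, t}. sum f (in_arcs G v) = sum f (out_arcs G v))"

definition flow_value :: "('a, 'b) pre_digraph \<Rightarrow> 'a \<Rightarrow> ('b \<Rightarrow> real) \<Rightarrow> real" where
  "flow_value G s f = sum f (out_arcs G s) - sum f (in_arcs G s)"

definition is_max_flow :: "('a, 'b) pre_digraph \<Rightarrow> 'a \<Rightarrow> 'a \<Rightarrow> ('b \<Rightarrow> real) \<Rightarrow> bool" where
  "is_max_flow G s t f \<longleftrightarrow>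
     is_flow G s t f \<and> (\<forall>g. is_flow G s t g \<longrightarrow> flow_value G s g \<le> flow_value G s f)"

definition has_max_flow_value :: "('a, 'b) pre_digraph \<Rightarrow> 'a \<Rightarrow> 'a \<Rightarrow> real \<Rightarrow> bool" where
  "has_max_flow_value G s t x \<longleftrightarrow> (\<exists>f. is_max_flow G s t f \<and> flow_value G s f = x)"


definition st_cuts :: "('a, 'b) pre_digraph \<Rightarrow> 'a \<Rightarrow> 'a \<Rightarrow> 'a set set" where
  "st_cuts G s t = {S. S \<subseteq> verts G \<and> s \<in> S \<and> t \<notin> S}"

definition cut_size :: "('a, 'b) pre_digraph \<Rightarrow> 'a set \<Rightarrow> nat" where
  "cut_size G S = card {e \<in> arcs G. tail G e \<in> S \<and> head G e \<notin> S}"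

definition min_cut_size :: "('a, 'b) pre_digraph \<Rightarrow> 'a \<Rightarrow> 'a \<Rightarrow> nat" where
  "min_cut_size G s t = Min (cut_size G ` st_cuts G s t)"


text \<open>
  A data structure is a bit string \<open>D\<close> together with an arbitrary procedure \<open>query\<close> that answers
  from \<open>D\<close> and the failed edges alone; it is an oracle for \<open>G\<close> if all answers are right. Space is the
  length of \<open>D\<close>. A lower bound only makes sense if \<open>query\<close> is fixed before the graph is chosen, since
  otherwise \<open>query\<close> could have all answers for one graph built in.
\<close>

definition dual_ft_min_cut_oracle ::
  "(bool list \<Rightarrow> 'b set \<Rightarrow> nat) \<Rightarrow> bool list \<Rightarrow> ('a, 'b) pre_digraph \<Rightarrow> 'a \<Rightarrow> 'a \<Rightarrow> bool" where
  "dual_ft_min_cut_oracle query D G s t \<longleftrightarrow>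
     (\<forall>F. F \<subseteq> arcs G \<and> card F = 2 \<longrightarrow> query D F = min_cut_size (delete_arcs G F) s t)"

end

theory Submission
  imports Defs
begin

text \<open>
  Take \<open>2 p\<close> vertex-disjoint chains from \<open>s\<close> to \<open>t\<close>, each with \<open>L\<close> inner vertices, where the first
  \<open>p\<close> chains are called left and the others right. For every left chain \<open>c\<close>, right chain \<open>d\<close> and
  level \<open>k\<close>, one bit decides whether there is a cross arc from the \<open>k\<close>-th vertex of \<open>c\<close> to the
  \<open>k\<close>-th vertex of \<open>d\<close>. If the arc of \<open>c\<close> leaving level \<open>k\<close> and the arc of \<open>d\<close> entering level \<open>k\<close>
  fail, then the flow on \<open>c\<close> can only be diverted to \<open>t\<close> along a cross arc from \<open>c\<close> to \<open>d\<close> at a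
  level that is at most \<open>k\<close> and at least \<open>k\<close>. Hence the two failures reveal the bit \<open>(c, d, k)\<close>, and an
  oracle has to store all \<open>p\<^sup>2 L\<close> bits. With \<open>p L\<close> of order \<open>n\<close>, with \<open>p\<close> of order \<open>r\<close>, and
  with direct arcs from \<open>s\<close> to \<open>t\<close> making up for the difference of \<open>p\<close> and \<open>r\<close>, this is of order \<open>n r\<close>.
\<close>

section \<open>Flows, cuts and counting\<close>

text \<open>Unit capacities bound the flow out of \<open>s\<close> by its out-degree, and flow into
  \<open>s\<close> only lowers the value. A flow attaining this bound is maximum without any appeal
  to duality.\<close>

lemma has_max_flow_value_out_arcs:
  assumes "fin_digraph G" "is_flow G s t f" "flow_value G s f = real (card (out_arcs G s))"
  shows "has_max_flow_value G s t (real (card (out_arcs G s)))"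
proof -
  interpret fin_digraph G by fact
  have "flow_value G s g \<le> real (card (out_arcs G s))" if g: "is_flow G s t g" for g
  proof -
    have "sum g (out_arcs G s) \<le> (\<Sum>e\<in>out_arcs G s. 1)"
      using g by (intro sum_mono) (auto simp: is_flow_def)
    moreover have "0 \<le> sum g (in_arcs G s)"
      using g by (intro sum_nonneg) (auto simp: is_flow_def)
    ultimately show ?thesis by (simp add: flow_value_def)
  qed
  then show ?thesis
    using assms by (auto simp: has_max_flow_value_def is_max_flow_def)
qed

lemma finite_st_cuts: "finite (verts G) \<Longrightarrow> finite (st_cuts G s t)"
  by (auto simp: st_cuts_def intro: finite_subset[of _ "Pow (verts G)"])

lemma min_cut_size_le:
  "finite (verts G) \<Longrightarrow> S \<in> st_cuts G s t \<Longrightarrow> min_cut_size G s t \<le> cut_size G S"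
  unfolding min_cut_size_def by (simp add: finite_st_cuts)

lemma min_cut_size_ge:
  assumes "finite (verts G)" "s \<in> verts G" "s \<noteq> t"
    and "\<And>S. S \<in> st_cuts G s t \<Longrightarrow> m \<le> cut_size G S"
  shows "m \<le> min_cut_size G s t"
proof -
  have "{s} \<in> st_cuts G s t"
    using assms by (auto simp: st_cuts_def)
  then show ?thesis
    unfolding min_cut_size_def using assms by (subst Min_ge_iff) (auto simp: finite_st_cuts)
qed

lemma sequence_leaves_set:
  "u 0 \<in> S \<Longrightarrow> u m \<notin> S \<Longrightarrow> \<exists>i<m. u i \<in> S \<and> u (Suc i) \<notin> S" for m :: nat
  by (induction m) (auto intro: less_SucI)

lemma card_bool_lists_shorter: "card {D :: bool list. length D < b} < 2 ^ b"
proof (cases b)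
  case (Suc m)
  have "card {D :: bool list. length D < b} = (\<Sum>i\<le>m. 2 ^ i)"
    using card_lists_length_le[of "UNIV :: bool set" m] by (simp add: Suc less_Suc_eq_le)
  also have "\<dots> < 2 ^ Suc m"
    by (induction m) auto
  finally show ?thesis by (simp add: Suc)
qed simp

text \<open>If two instances shared a bit string, the fixed \<open>query\<close> would answer alike
  on both, contradicting the failure that separates them. So the strings are pairwise distinct, and
  fewer than \<open>2 ^ b\<close> strings are shorter than \<open>b\<close>.\<close>

lemma oracle_space_lower_bound:
  fixes G :: "'i \<Rightarrow> ('a, 'b) pre_digraph"
  assumes "finite X" "2 ^ b \<le> card X"
    and distinguish: "\<And>x y. x \<in> X \<Longrightarrow> y \<in> X \<Longrightarrow> x \<noteq> y \<Longrightarrow>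
      \<exists>F. F \<subseteq> arcs (G x) \<and> F \<subseteq> arcs (G y) \<and> card F = 2 \<and>
        min_cut_size (delete_arcs (G x) F) (s x) (t x) \<noteq>
        min_cut_size (delete_arcs (G y) F) (s y) (t y)"
  shows "\<exists>x\<in>X. \<forall>D. dual_ft_min_cut_oracle query D (G x) (s x) (t x) \<longrightarrow> b \<le> length D"
proof (rule ccontr)
  assume "\<not> ?thesis"
  then have "\<forall>x\<in>X. \<exists>D. dual_ft_min_cut_oracle query D (G x) (s x) (t x) \<and> length D < b"
    by (metis not_le)
  then obtain D where D: "\<And>x. x \<in> X \<Longrightarrow> dual_ft_min_cut_oracle query (D x) (G x) (s x) (t x)"
    and short: "\<And>x. x \<in> X \<Longrightarrow> length (D x) < b"
    by metis
  have "inj_on D X"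
  proof (rule inj_onI, rule ccontr)
    fix x y assume xy: "x \<in> X" "y \<in> X" "D x = D y" "x \<noteq> y"
    then show False
      using distinguish[of x y] D[of x] D[of y] unfolding dual_ft_min_cut_oracle_def by metis
  qed
  moreover have "finite {D :: bool list. length D < b}"
    by (rule finite_subset[OF _ finite_lists_length_le[of UNIV b]]) auto
  ultimately have "card X \<le> card {D :: bool list. length D < b}"
    using short by (intro card_inj_on_le[of D]) auto
  then show False
    using card_bool_lists_shorter[of b] assms(2) by simp
qed

section \<open>The chain network\<close>

definition edge_digraph :: "nat \<Rightarrow> edge set \<Rightarrow> (nat, edge) pre_digraph" where
  "edge_digraph n A = \<lparr>verts = {..<n}, arcs = A, tail = fst, head = fst \<circ> snd\<rparr>"

lemma edge_digraph_simps [simp]: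
  "verts (edge_digraph n A) = {..<n}"
  "arcs (edge_digraph n A) = A"
  "tail (edge_digraph n A) (u, v, k) = u"
  "head (edge_digraph n A) (u, v, k) = v"
  "delete_arcs (edge_digraph n A) F = edge_digraph n (A - F)"
  by (simp_all add: edge_digraph_def delete_arcs_def)

lemma n_vertex_digraph_edge_digraph:
  assumes "finite A" "\<And>u v k. (u, v, k) \<in> A \<Longrightarrow> u < n \<and> v < n"
  shows "n_vertex_digraph n (edge_digraph n A)"
  unfolding n_vertex_digraph_def using assms
  by (auto simp: edge_digraph_def intro!: fin_digraph.intro wf_digraph.intro fin_digraph_axioms.intro)

lemma cut_size_edge_digraph:
  "cut_size (edge_digraph n A) S = card {(u, v, k). (u, v, k) \<in> A \<and> u \<in> S \<and> v \<notin> S}"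
  unfolding cut_size_def by (rule arg_cong[of _ _ card]) auto

locale chain_network =
  fixes n r p L :: nat
  assumes p_pos: "0 < p" and p_le: "p \<le> r" and room: "2 + 2 * p * L \<le> n"
begin

text \<open>
  The source is \<open>0\<close> and the sink is \<open>1\<close>. Chain \<open>c\<close> consists of \<open>node c 0, \<dots>, node c (len c + 1)\<close>, and
  the index of an arc is the number of its chain (for a cross arc, of the left chain).
\<close>

definition len :: "nat \<Rightarrow> nat" where
  "len c = (if c < 2 * p then L else 0)"

text \<open>Inner vertices are numbered level by level, from \<open>2\<close> on. Every position
  past the end is the sink, so a chain with \<open>len c = 0\<close> is one direct arc.\<close>

definition node :: "nat \<Rightarrow> nat \<Rightarrow> nat" where
  "node c k = (if k = 0 then 0 else if k \<le> len c then 2 + (2 * p * (k - 1) + c) else 1)"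

definition chain_arc :: "nat \<Rightarrow> nat \<Rightarrow> edge" where
  "chain_arc c k = (node c k, node c (Suc k), c)"

definition chain_arcs :: "edge set" where
  "chain_arcs = {chain_arc c k |c k. c < 2 * r \<and> k \<le> len c}"

definition positions :: "(nat \<times> nat \<times> nat) set" where
  "positions = {..<p} \<times> {p..<2 * p} \<times> {1..L}"

definition cross_arc :: "nat \<times> nat \<times> nat \<Rightarrow> edge" where
  "cross_arc = (\<lambda>(c, d, k). (node c k, node d k, c))"

definition network :: "(nat \<times> nat \<times> nat) set \<Rightarrow> (nat, edge) pre_digraph" where
  "network X = edge_digraph n (chain_arcs \<union> cross_arc ` X)"

lemma finite_positions: "finite positions" and card_positions: "card positions = p * p * L"
  by (auto simp: positions_def)

lemma node_0 [simp]: "node c 0 = 0"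
  by (simp add: node_def)

lemma node_end [simp]: "len c < k \<Longrightarrow> node c k = 1"
  by (simp add: node_def)

lemma node_eq_0_iff [simp]: "node c k = 0 \<longleftrightarrow> k = 0"
  by (simp add: node_def)

lemma node_eq_1_iff [simp]: "node c k = Suc 0 \<longleftrightarrow> len c < k"
  by (auto simp: node_def)

lemma len_pos_imp: "1 \<le> k \<Longrightarrow> k \<le> len c \<Longrightarrow> c < 2 * p \<and> k \<le> L"
  by (auto simp: len_def split: if_splits)

lemma node_inject:
  assumes "node c k = node d j" "1 \<le> k" "k \<le> len c"
  shows "c = d \<and> k = j"
proof -
  have j: "1 \<le> j" "j \<le> len d"
    using assms by (auto simp: node_def split: if_splits)
  have lt: "c < 2 * p" "d < 2 * p"
    using len_pos_imp assms j by blast+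
  have eq: "2 * p * (k - 1) + c = 2 * p * (j - 1) + d"
    using assms j by (auto simp: node_def)
  \<comment> \<open>Chain numbers are remainders modulo \<open>2 * p\<close>, levels come from the
    quotients.\<close>
  have "c = d"
    using arg_cong[OF eq, of "\<lambda>m. m mod (2 * p)"] lt by simp
  moreover have "k - 1 = j - 1"
    using arg_cong[OF eq, of "\<lambda>m. m div (2 * p)"] lt p_pos by simp
  ultimately show ?thesis using assms j by simp
qed

lemma node_less: "node c k < n"
proof (cases "1 \<le> k \<and> k \<le> len c")
  case True
  then have "c < 2 * p" "k \<le> L"
    using len_pos_imp by blast+
  then have "2 * p * (k - 1) + c < 2 * p * (k - 1) + 2 * p * 1" by simp
  also have "\<dots> = 2 * p * k"
    using True by (metis distrib_left le_add_diff_inverse2)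
  also have "\<dots> \<le> 2 * p * L"
    using \<open>k \<le> L\<close> by simp
  finally show ?thesis
    using True room by (simp add: node_def)
next
  case False
  then show ?thesis using room by (auto simp: node_def)
qed

lemma finite_chain_arcs: "finite chain_arcs"
proof -
  have "chain_arcs \<subseteq> (\<lambda>(c, k). chain_arc c k) ` ({..<2 * r} \<times> {..L})"
    by (force simp: chain_arcs_def len_def split: if_splits)
  then show ?thesis by (rule finite_subset) simp
qed

lemma n_vertex_digraph_network:
  assumes "X \<subseteq> positions"
  shows "n_vertex_digraph n (network X)"
  unfolding network_def
proof (rule n_vertex_digraph_edge_digraph)
  show "finite (chain_arcs \<union> cross_arc ` X)"
    using finite_chain_arcs finite_subset[OF assms finite_positions] by simp
qed (auto simp: chain_arcs_def chain_arc_def cross_arc_def node_less)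

section \<open>Maximum flow of the network\<close>

lemma sum_chain_arcs_in:
  assumes "X \<subseteq> positions"
  shows "(\<Sum>e\<in>in_arcs (network X) v. of_bool (e \<in> chain_arcs)) =
    real (card {e \<in> chain_arcs. fst (snd e) = v})"
proof -
  interpret fin_digraph "network X"
    using n_vertex_digraph_network[OF assms] by (simp add: n_vertex_digraph_def)
  have "in_arcs (network X) v \<inter> {e. e \<in> chain_arcs} = {e \<in> chain_arcs. fst (snd e) = v}"
    by (auto simp: network_def edge_digraph_def in_arcs_def)
  then show ?thesis by (subst sum_of_bool_eq) auto
qed

lemma sum_chain_arcs_out:
  assumes "X \<subseteq> positions"
  shows "(\<Sum>e\<in>out_arcs (network X) v. of_bool (e \<in> chain_arcs)) =
    real (card {e \<in> chain_arcs. fst e = v})"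
proof -
  interpret fin_digraph "network X"
    using n_vertex_digraph_network[OF assms] by (simp add: n_vertex_digraph_def)
  have "out_arcs (network X) v \<inter> {e. e \<in> chain_arcs} = {e \<in> chain_arcs. fst e = v}"
    by (auto simp: network_def edge_digraph_def out_arcs_def)
  then show ?thesis by (subst sum_of_bool_eq) auto
qed

text \<open>Chains share no inner vertex, so such a vertex has one chain arc in and one out; any
  other vertex but the terminals lies on no chain.\<close>

lemma chain_arcs_balanced:
  assumes "v \<noteq> 0" "v \<noteq> 1"
  shows "card {e \<in> chain_arcs. fst (snd e) = v} = card {e \<in> chain_arcs. fst e = v}"
proof (cases "\<exists>c k. v = node c k \<and> 1 \<le> k \<and> k \<le> len c")
  case True
  then obtain c k where v: "v = node c k" and k: "1 \<le> k" "k \<le> len c" by blast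
  have c: "c < 2 * r"
    using len_pos_imp[OF k] p_le by simp
  have "{e \<in> chain_arcs. fst (snd e) = v} \<subseteq> {chain_arc c (k - 1)}"
    using k by (auto simp: chain_arcs_def chain_arc_def v dest!: node_inject[OF _ k, OF sym])
  moreover have "chain_arc c (k - 1) \<in> chain_arcs"
    using k c by (fastforce simp: chain_arcs_def)
  ultimately have "{e \<in> chain_arcs. fst (snd e) = v} = {chain_arc c (k - 1)}"
    using k by (auto simp: chain_arc_def v)
  moreover have "{e \<in> chain_arcs. fst e = v} = {chain_arc c k}"
    using k c by (auto simp: chain_arcs_def chain_arc_def v dest!: node_inject[OF _ k, OF sym])
  ultimately show ?thesis by simp
next
  case False
  have none: "node c k \<noteq> v" for c k
    using False assms by (metis Suc_le_eq linorder_not_less node_0 node_end not_gr_zero One_nat_def)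
  then show ?thesis by (simp add: chain_arcs_def chain_arc_def) (metis (no_types, lifting) fst_conv snd_conv)
qed

lemma out_arcs_network_source:
  assumes "X \<subseteq> positions"
  shows "out_arcs (network X) 0 = {e \<in> chain_arcs. fst e = 0}"
    and "card (out_arcs (network X) 0) = 2 * r"
proof -
  show *: "out_arcs (network X) 0 = {e \<in> chain_arcs. fst e = 0}"
    using assms by (auto simp: network_def out_arcs_def cross_arc_def positions_def)
  have "{e \<in> chain_arcs. fst e = 0} = (\<lambda>c. chain_arc c 0) ` {..<2 * r}"
    by (auto simp: chain_arcs_def chain_arc_def)
  moreover have "inj_on (\<lambda>c. chain_arc c 0) {..<2 * r}"
    by (auto simp: inj_on_def chain_arc_def)
  ultimately show "card (out_arcs (network X) 0) = 2 * r"
    by (simp add: * card_image)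
qed

lemma has_max_flow_value_network:
  assumes "X \<subseteq> positions"
  shows "has_max_flow_value (network X) 0 1 (2 * real r)"
proof -
  \<comment> \<open>One unit along each of the \<open>2 * r\<close> chains and nothing on cross arcs
    saturates the source.\<close>
  define f :: "edge \<Rightarrow> real" where "f = (\<lambda>e. of_bool (e \<in> chain_arcs))"
  have fin: "fin_digraph (network X)"
    using n_vertex_digraph_network[OF assms] by (simp add: n_vertex_digraph_def)
  have "is_flow (network X) 0 1 f"
    unfolding is_flow_def f_def sum_chain_arcs_in[OF assms] sum_chain_arcs_out[OF assms]
    by (simp add: chain_arcs_balanced)
  moreover have "{e \<in> chain_arcs. fst (snd e) = 0} = {}"
    by (auto simp: chain_arcs_def chain_arc_def)
  then have "flow_value (network X) 0 f = real (card (out_arcs (network X) 0))"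
    unfolding flow_value_def f_def sum_chain_arcs_in[OF assms] sum_chain_arcs_out[OF assms]
    by (simp only: out_arcs_network_source(1)[OF assms]) simp
  ultimately show ?thesis
    using has_max_flow_value_out_arcs[OF fin] out_arcs_network_source(2)[OF assms] by fastforce
qed

section \<open>Minimum cuts after two failures\<close>

definition failure :: "nat \<times> nat \<times> nat \<Rightarrow> edge set" where
  "failure = (\<lambda>(c, d, k). {chain_arc c k, chain_arc d (k - 1)})"

text \<open>Only chain arcs fail, and these lie in every network, so the same query can be put to
  any two of them.\<close>

lemma failure_subset:
  assumes "q \<in> positions"
  shows "failure q \<subseteq> chain_arcs"
proof -
  have "chain_arc c k \<in> chain_arcs" if "c < 2 * p" "k \<le> L" for c k
  proof -
    have "c < 2 * r" "k \<le> len c"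
      using that p_le by (auto simp: len_def)
    then show ?thesis unfolding chain_arcs_def by blast
  qed
  then show ?thesis
    using assms by (auto simp: failure_def positions_def)
qed

lemma card_failure: "q \<in> positions \<Longrightarrow> card (failure q) = 2"
  by (auto simp: failure_def positions_def chain_arc_def)

lemma delete_arcs_network:
  "delete_arcs (network X) F = edge_digraph n ((chain_arcs \<union> cross_arc ` X) - F)"
  by (simp add: network_def)

text \<open>
  Distinct arc indices are counted instead of arcs: a cut contains an arc of every intact chain, and
  one of index \<open>c\<close> or \<open>d\<close> on the path that changes from chain \<open>c\<close> to chain \<open>d\<close> at level \<open>k\<close>.
\<close>

lemma min_cut_size_bit_set:
  assumes X: "X \<subseteq> positions" and q: "q \<in> X"
  shows "2 * r - 1 \<le> min_cut_size (delete_arcs (network X) (failure q)) 0 1"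
  unfolding delete_arcs_network
proof (rule min_cut_size_ge)
  fix S assume "S \<in> st_cuts (edge_digraph n (chain_arcs \<union> cross_arc ` X - failure q)) 0 1"
  then have S: "0 \<in> S" "1 \<notin> S" by (auto simp: st_cuts_def)
  obtain c d k where q_eq: "q = (c, d, k)" by (cases q)
  have cdk: "c < p" "p \<le> d" "d < 2 * p" "1 \<le> k" "k \<le> L"
    using X q by (auto simp: q_eq positions_def)
  have len: "len c = L" "len d = L"
    using cdk by (auto simp: len_def)
  define C where "C = {(u, v, i). (u, v, i) \<in> chain_arcs \<union> cross_arc ` X - failure q \<and> u \<in> S \<and> v \<notin> S}"
  let ?index = "\<lambda>e::edge. snd (snd e)"
  have fin: "finite C"
    by (rule finite_subset[of _ "chain_arcs \<union> cross_arc ` X"])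
      (auto simp: C_def finite_chain_arcs finite_subset[OF X finite_positions])
  have C_chain: "e \<in> ?index ` C"
    if "e < 2 * r" "i \<le> len e" "node e i \<in> S" "node e (Suc i) \<notin> S" "chain_arc e i \<notin> failure q" for e i
  proof -
    have "chain_arc e i \<in> C"
      using that by (auto simp: C_def chain_arcs_def chain_arc_def)
    then show ?thesis by (force simp: chain_arc_def)
  qed
  have intact: "{..<2 * r} - {c, d} \<subseteq> ?index ` C"
  proof
    fix e assume e: "e \<in> {..<2 * r} - {c, d}"
    have "\<exists>i<Suc (len e). node e i \<in> S \<and> node e (Suc i) \<notin> S"
      by (rule sequence_leaves_set) (use S in simp_all)
    then obtain i where "i \<le> len e" "node e i \<in> S" "node e (Suc i) \<notin> S"
      by (auto simp: less_Suc_eq_le)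
    then show "e \<in> ?index ` C"
      using e by (intro C_chain) (auto simp: failure_def q_eq chain_arc_def)
  qed
  \<comment> \<open>The detour: chain \<open>c\<close> up to level \<open>k\<close>, then the cross
    arc to level \<open>k\<close> of \<open>d\<close>. The level on \<open>d\<close> lags by one
    because the cross arc is a step that keeps the level.\<close>
  define u where "u i = (if i \<le> k then node c i else node d (i - 1))" for i
  have "\<exists>i<Suc (Suc L). u i \<in> S \<and> u (Suc i) \<notin> S"
    by (rule sequence_leaves_set) (use S cdk in \<open>simp_all add: u_def len\<close>)
  then obtain i where i: "i \<le> Suc L" "u i \<in> S" "u (Suc i) \<notin> S"
    by (auto simp: less_Suc_eq_le)
  consider "i < k" | "i = k" | "k < i" by linarith
  then have "c \<in> ?index ` C \<or> d \<in> ?index ` C"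
  proof cases
    case 1
    have "node c i \<noteq> node c k"
      using node_inject[of c k c i] 1 cdk len by auto
    then have "c \<in> ?index ` C"
      using 1 i cdk p_le len by (intro C_chain[of c i]) (auto simp: failure_def q_eq chain_arc_def u_def)
    then show ?thesis ..
  next
    case 2
    \<comment> \<open>The cross arc has index \<open>c\<close>, so it could coincide only with the
      failed \<open>chain_arc c k\<close>; the heads differ.\<close>
    have "node d k \<noteq> node c (Suc k)"
      using node_inject[of d k c "Suc k"] cdk len by auto
    then have "cross_arc q \<in> C"
      using 2 i q cdk by (auto simp: C_def cross_arc_def failure_def q_eq chain_arc_def u_def
          intro!: image_eqI[of _ _ "(c, d, k)"])
    then show ?thesis by (force simp: cross_arc_def q_eq)
  next
    case 3
    have "node d i \<noteq> node d k"
      using node_inject[of d k d i] 3 cdk len by auto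
    then have "d \<in> ?index ` C"
      using 3 i cdk p_le len by (intro C_chain[of d "i - 1"]) (auto simp: failure_def q_eq chain_arc_def u_def)
    then show ?thesis ..
  qed
  then obtain e where e: "e \<in> {c, d}" "e \<in> ?index ` C" by blast
  have "2 * r - 1 = card (insert e ({..<2 * r} - {c, d}))"
    using e cdk p_le by (simp add: card_Diff_subset)
  also have "\<dots> \<le> card (?index ` C)"
    using intact e fin by (intro card_mono) auto
  also have "\<dots> \<le> card C"
    by (rule card_image_le[OF fin])
  finally show "2 * r - 1 \<le> cut_size (edge_digraph n (chain_arcs \<union> cross_arc ` X - failure q)) S"
    by (simp add: cut_size_edge_digraph C_def)
qed (use room in auto)

text \<open>A cut is exhibited: with the source go chain \<open>c\<close> up to level
  \<open>k\<close>, chain \<open>d\<close> below level \<open>k\<close>, and all other right chains.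
  On \<open>c\<close> and \<open>d\<close> the leaving arc has failed. A cross arc leaving the set
  starts on \<open>c\<close> at level at most \<open>k\<close> and ends on \<open>d\<close> at level
  at least \<open>k\<close>, so it would be the absent one.\<close>

lemma min_cut_size_bit_unset:
  assumes X: "X \<subseteq> positions" and q: "q \<in> positions" "q \<notin> X"
  shows "min_cut_size (delete_arcs (network X) (failure q)) 0 1 \<le> 2 * r - 2"
proof -
  obtain c d k where q_eq: "q = (c, d, k)" by (cases q)
  have cdk: "c < p" "p \<le> d" "d < 2 * p" "1 \<le> k" "k \<le> L"
    using q by (auto simp: q_eq positions_def)
  define Q where "Q e i \<longleftrightarrow> e = c \<and> i \<le> k \<or> e = d \<and> i < k \<or> p \<le> e \<and> e \<noteq> d" for e i
  define S where "S = insert 0 {node e i |e i. 1 \<le> i \<and> i \<le> len e \<and> Q e i}"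
  have node_S: "node e i \<in> S \<longleftrightarrow> Q e i" if "1 \<le> i" "i \<le> len e" for e i
    using that by (auto simp: S_def dest: node_inject)
  have one: "1 \<notin> S"
    unfolding S_def using node_eq_1_iff by (auto simp del: node_eq_1_iff) (metis leD)
  have cut: "S \<in> st_cuts (edge_digraph n A) 0 1" for A
    using one room by (auto simp: st_cuts_def S_def node_less)
  \<comment> \<open>The one arc by which any other chain leaves \<open>S\<close>: the last arc of a
    right chain, the first of a left chain. On a direct chain the two coincide.\<close>
  define h where "h e = (if p \<le> e then chain_arc e (len e) else chain_arc e 0)" for e
  have "{(u, v, i). (u, v, i) \<in> chain_arcs \<union> cross_arc ` X - failure q \<and> u \<in> S \<and> v \<notin> S}
      \<subseteq> h ` ({..<2 * r} - {c, d})"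
  proof clarify
    fix u v l assume uv: "u \<in> S" "v \<notin> S" and notF: "(u, v, l) \<notin> failure q"
      and "(u, v, l) \<in> chain_arcs \<union> cross_arc ` X"
    then consider (chain) "(u, v, l) \<in> chain_arcs" | (cross) "(u, v, l) \<in> cross_arc ` X" by blast
    then show "(u, v, l) \<in> h ` ({..<2 * r} - {c, d})"
    proof cases
      case chain
      then obtain e i where ei: "(u, v, l) = chain_arc e i" "e < 2 * r" "i \<le> len e"
        by (auto simp: chain_arcs_def)
      have u: "i = 0 \<or> Q e i"
        using uv ei node_S[of i e] by (cases i) (auto simp: chain_arc_def)
      have v: "i = len e \<or> \<not> Q e (Suc i)"
        using uv ei node_S[of "Suc i" e] by (auto simp: chain_arc_def)
      have F: "\<not> (e = c \<and> i = k)" "\<not> (e = d \<and> i = k - 1)"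
        using notF ei by (auto simp: failure_def q_eq)
      have "e \<noteq> c \<and> e \<noteq> d \<and> (u, v, l) = h e"
        using u v F cdk ei by (auto simp: Q_def h_def len_def split: if_splits)
      then show ?thesis using ei by auto
    next
      case cross
      then obtain c' d' k' where x: "(c', d', k') \<in> X" "u = node c' k'" "v = node d' k'"
        by (auto simp: cross_arc_def)
      then have b: "c' < p" "p \<le> d'" "d' < 2 * p" "1 \<le> k'" "k' \<le> L"
        using X by (auto simp: positions_def)
      then have "Q c' k'" "\<not> Q d' k'"
        using uv x node_S[of k' c'] node_S[of k' d'] by (auto simp: len_def)
      then have "(c', d', k') = q"
        using b cdk by (auto simp: Q_def q_eq)
      then show ?thesis using x q by simp
    qed
  qed
  then have "cut_size (delete_arcs (network X) (failure q)) S \<le> card ({..<2 * r} - {c, d})"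
    unfolding delete_arcs_network cut_size_edge_digraph
    by (meson card_image_le card_mono finite_Diff finite_imageI finite_lessThan le_trans)
  also have "\<dots> = 2 * r - 2"
    using cdk p_le by (simp add: card_Diff_subset)
  finally show ?thesis
    unfolding delete_arcs_network by (rule order_trans[OF min_cut_size_le[OF _ cut], rotated]) simp
qed

text \<open>All \<open>2 ^ (p * p * L)\<close> subsets of \<open>positions\<close> compete. Where
  two of them differ, the failure leaves a min-cut of at least \<open>2 * r - 1\<close> in one
  network and at most \<open>2 * r - 2\<close> in the other.\<close>

theorem network_oracle_space:
  "\<exists>X\<subseteq>positions. \<forall>D. dual_ft_min_cut_oracle query D (network X) 0 1 \<longrightarrow> p * p * L \<le> length D"
proof -
  have differ: "min_cut_size (delete_arcs (network X) (failure q)) 0 1 \<noteq>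
      min_cut_size (delete_arcs (network Y) (failure q)) 0 1"
    if "X \<subseteq> positions" "Y \<subseteq> positions" "q \<in> X" "q \<notin> Y" for X Y q
    using min_cut_size_bit_set[of X q] min_cut_size_bit_unset[of Y q] that p_pos p_le by force
  have "\<exists>X\<in>Pow positions. \<forall>D. dual_ft_min_cut_oracle query D (network X) 0 1 \<longrightarrow> p * p * L \<le> length D"
  proof (rule oracle_space_lower_bound)
    fix X Y assume XY: "X \<in> Pow positions" "Y \<in> Pow positions" "X \<noteq> Y"
    then obtain q where q: "q \<in> X \<and> q \<notin> Y \<or> q \<in> Y \<and> q \<notin> X" by blast
    then have "q \<in> positions" using XY by blast
    then have "failure q \<subseteq> arcs (network X)" "failure q \<subseteq> arcs (network Y)" "card (failure q) = 2"
      using failure_subset[of q] card_failure[of q] by (auto simp: network_def)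
    moreover have "min_cut_size (delete_arcs (network X) (failure q)) 0 1 \<noteq>
        min_cut_size (delete_arcs (network Y) (failure q)) 0 1"
      using q differ[of X Y q] differ[of Y X q] XY by auto
    ultimately show "\<exists>F. F \<subseteq> arcs (network X) \<and> F \<subseteq> arcs (network Y) \<and> card F = 2 \<and>
        min_cut_size (delete_arcs (network X) F) 0 1 \<noteq> min_cut_size (delete_arcs (network Y) F) 0 1"
      by blast
  qed (auto simp: finite_positions card_Pow card_positions)
  then show ?thesis by auto
qed

end

section \<open>At most three vertices\<close>

text \<open>
  The chain network needs four vertices. For fewer, a single bit is enough: the query does not know
  which of \<open>0\<close> and \<open>1\<close> is the source, and in the second graph the failing arcs lead into the source.
\<close>

definition bundle_digraph :: "nat \<Rightarrow> nat \<Rightarrow> bool \<Rightarrow> (nat, edge) pre_digraph" where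
  "bundle_digraph n r swap = edge_digraph n
     ({0} \<times> {1} \<times> {..<2 * r} \<union> (if swap then {1} \<times> {0} \<times> {..<2 * r} else {}))"

lemma bundle_digraph_oracle_space:
  assumes "2 \<le> n" "1 \<le> r"
  shows "\<exists>swap. \<forall>D. dual_ft_min_cut_oracle query D (bundle_digraph n r swap) (of_bool swap) (of_bool (\<not> swap))
    \<longrightarrow> 1 \<le> length D"
proof -
  \<comment> \<open>Both graphs contain these arcs since \<open>2 \<le> 2 * r\<close>. Losing them
    lowers the cut from \<open>0\<close> to \<open>1\<close>, but not the cut from \<open>1\<close>
    to \<open>0\<close> in the swapped graph.\<close>
  define F :: "edge set" where "F = {0} \<times> {1} \<times> {0, 1}"
  have F: "F \<subseteq> arcs (bundle_digraph n r swap)" "card F = 2" for swap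
    using assms by (auto simp: F_def bundle_digraph_def)
  have "min_cut_size (delete_arcs (bundle_digraph n r False) F) 0 1 \<le>
      cut_size (delete_arcs (bundle_digraph n r False) F) {0}"
    using assms by (intro min_cut_size_le) (auto simp: bundle_digraph_def st_cuts_def)
  also have "\<dots> = card ({0 :: nat} \<times> {1 :: nat} \<times> {2..<2 * r})"
    unfolding bundle_digraph_def edge_digraph_simps cut_size_edge_digraph F_def
    by (rule arg_cong[of _ _ card]) auto
  also have "\<dots> < 2 * r"
    using assms by (simp add: card_cartesian_product)
  also have "2 * r \<le> min_cut_size (delete_arcs (bundle_digraph n r True) F) 1 0"
  proof (rule min_cut_size_ge)
    fix S assume "S \<in> st_cuts (delete_arcs (bundle_digraph n r True) F) 1 0"
    then have "1 \<in> S" "0 \<notin> S" by (auto simp: st_cuts_def)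
    then have "cut_size (delete_arcs (bundle_digraph n r True) F) S = card ({1 :: nat} \<times> {0 :: nat} \<times> {..<2 * r})"
      unfolding bundle_digraph_def edge_digraph_simps cut_size_edge_digraph F_def
      by (intro arg_cong[of _ _ card]) auto
    then show "2 * r \<le> cut_size (delete_arcs (bundle_digraph n r True) F) S"
      by (simp add: card_cartesian_product)
  qed (use assms in \<open>auto simp: bundle_digraph_def\<close>)
  finally have differ: "min_cut_size (delete_arcs (bundle_digraph n r False) F) 0 1 \<noteq>
      min_cut_size (delete_arcs (bundle_digraph n r True) F) 1 0"
    by simp
  have "\<exists>swap\<in>UNIV. \<forall>D. dual_ft_min_cut_oracle query D (bundle_digraph n r swap)
      (of_bool swap) (of_bool (\<not> swap)) \<longrightarrow> 1 \<le> length D"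
  proof (rule oracle_space_lower_bound)
    fix x y :: bool assume "x \<noteq> y"
    then show "\<exists>F. F \<subseteq> arcs (bundle_digraph n r x) \<and> F \<subseteq> arcs (bundle_digraph n r y) \<and> card F = 2 \<and>
        min_cut_size (delete_arcs (bundle_digraph n r x) F) (of_bool x) (of_bool (\<not> x)) \<noteq>
        min_cut_size (delete_arcs (bundle_digraph n r y) F) (of_bool y) (of_bool (\<not> y))"
      using F differ by (intro exI[of _ F]) (cases x; cases y; auto)
  qed auto
  then show ?thesis by simp
qed

lemma n_vertex_digraph_bundle_digraph: "2 \<le> n \<Longrightarrow> n_vertex_digraph n (bundle_digraph n r swap)"
  unfolding bundle_digraph_def by (rule n_vertex_digraph_edge_digraph) (auto split: if_splits)

lemma has_max_flow_value_bundle_digraph: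
  assumes "2 \<le> n"
  shows "has_max_flow_value (bundle_digraph n r swap) (of_bool swap) (of_bool (\<not> swap)) (2 * real r)"
proof -
  let ?s = "of_bool swap :: nat" and ?t = "of_bool (\<not> swap) :: nat"
  define G where "G = bundle_digraph n r swap"
  \<comment> \<open>Arcs into the source carry nothing; conservation is trivial because all other
    vertices but the sink are isolated.\<close>
  define f :: "edge \<Rightarrow> real" where "f = (\<lambda>(u, v, k). of_bool (u = ?s))"
  have fin: "fin_digraph G"
    using n_vertex_digraph_bundle_digraph[OF assms] by (simp add: n_vertex_digraph_def G_def)
  have out: "out_arcs G ?s = {?s} \<times> {?t} \<times> {..<2 * r}"
    by (auto simp: G_def bundle_digraph_def out_arcs_def split: if_splits)
  have "in_arcs G v = {}" "out_arcs G v = {}" if "v \<noteq> ?s" "v \<noteq> ?t" for v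
    using that by (auto simp: G_def bundle_digraph_def in_arcs_def out_arcs_def split: if_splits)
  then have "is_flow G ?s ?t f"
    by (auto simp: is_flow_def f_def)
  moreover have "sum f (out_arcs G ?s) = (\<Sum>e\<in>out_arcs G ?s. 1)"
    by (rule sum.cong) (auto simp: f_def out)
  moreover have "sum f (in_arcs G ?s) = 0"
    by (rule sum.neutral)
      (auto simp: f_def G_def bundle_digraph_def in_arcs_def split: if_splits)
  ultimately have "has_max_flow_value G ?s ?t (real (card (out_arcs G ?s)))"
    by (intro has_max_flow_value_out_arcs[OF fin]) (auto simp: flow_value_def)
  then show ?thesis
    unfolding out by (simp add: card_cartesian_product G_def)
qed

section \<open>The lower bound\<close>

lemma chain_network_parameters:
  fixes n r :: nat
  assumes "4 \<le> n" "1 \<le> r" "r \<le> n"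
  obtains p L where "chain_network n r p L" "n * r \<le> 50 * (p * p * L)"
proof -
  \<comment> \<open>\<open>N\<close> is the largest value of \<open>p * L\<close> that
    \<open>2 + 2 * p * L \<le> n\<close> permits. The factor \<open>5\<close> below is attained at
    \<open>n = 5\<close>, where \<open>N = 1\<close>.\<close>
  define N where "N = (n - 2) div 2"
  define p where "p = min r N"
  define L where "L = N div p"
  have N: "1 \<le> N" "n \<le> 5 * N" "2 + 2 * N \<le> n"
    using assms(1) unfolding N_def by presburger+
  have p: "0 < p" "p \<le> r" "p \<le> N" "r \<le> 5 * p"
    using N assms by (auto simp: p_def)
  have L: "0 < L" "p * L \<le> N"
    using p by (auto simp: L_def div_greater_zero_iff)
  \<comment> \<open>Rounding in \<open>N div p\<close> loses less than \<open>p\<close>, which is at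
    most \<open>p * L\<close>.\<close>
  have "N = p * L + N mod p"
    by (simp add: L_def)
  moreover have "N mod p < p" "p \<le> p * L"
    using p L by simp_all
  ultimately have half: "N \<le> 2 * (p * L)" by linarith
  \<comment> \<open>The constant is \<open>50 = 5 * 2 * 5\<close>: from \<open>n\<close> to
    \<open>N\<close>, from \<open>N\<close> to \<open>p * L\<close>, and from \<open>r\<close> to
    \<open>p\<close>.\<close>
  have "n * r \<le> (5 * N) * (5 * p)"
    using N p by (intro mult_mono) auto
  also have "\<dots> \<le> (5 * (2 * (p * L))) * (5 * p)"
    using half by (intro mult_mono) auto
  finally have "n * r \<le> 50 * (p * p * L)"
    by (simp add: algebra_simps)
  moreover have "chain_network n r p L"
    using p L N by unfold_locales (auto simp: mult.assoc)
  ultimately show ?thesis using that by blast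
qed

theorem theorem14:
  shows "\<exists>c::real. c > 0 \<and>
    (\<forall>n r :: nat. 2 \<le> n \<and> 1 \<le> r \<and> r \<le> n \<longrightarrow>
      (\<forall>query :: bool list \<Rightarrow> edge set \<Rightarrow> nat.
        \<exists>(G :: (nat, edge) pre_digraph) s t.
          n_vertex_digraph n G \<and> s \<in> verts G \<and> t \<in> verts G \<and> s \<noteq> t \<and>
          has_max_flow_value G s t (2 * real r) \<and>
          (\<forall>D. dual_ft_min_cut_oracle query D G s t \<longrightarrow>
             c * real n * real r \<le> real (length D))))"
proof (intro exI[of _ "1 / 50 :: real"] conjI allI impI)
  fix n r :: nat and query :: "bool list \<Rightarrow> edge set \<Rightarrow> nat"
  assume nr: "2 \<le> n \<and> 1 \<le> r \<and> r \<le> n"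
  have bound: "1 / 50 * real n * real r \<le> real l" if "n * r \<le> 50 * b" "b \<le> l" for b l
  proof -
    have "real (n * r) \<le> real (50 * l)"
      using that by (intro of_nat_mono) linarith
    then show ?thesis by simp
  qed
  show "\<exists>G s t. n_vertex_digraph n G \<and> s \<in> verts G \<and> t \<in> verts G \<and> s \<noteq> t \<and>
      has_max_flow_value G s t (2 * real r) \<and>
      (\<forall>D. dual_ft_min_cut_oracle query D G s t \<longrightarrow> 1 / 50 * real n * real r \<le> real (length D))"
  proof (cases "4 \<le> n")
    case True
    then obtain p L where "chain_network n r p L" and large: "n * r \<le> 50 * (p * p * L)"
      using chain_network_parameters nr by blast
    then interpret chain_network n r p L by simp
    obtain X where "X \<subseteq> positions"
      and "\<forall>D. dual_ft_min_cut_oracle query D (network X) 0 1 \<longrightarrow> p * p * L \<le> length D"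
      using network_oracle_space by blast
    then show ?thesis
      using n_vertex_digraph_network has_max_flow_value_network nr bound[OF large]
      by (intro exI[of _ "network X"] exI[of _ 0] exI[of _ 1]) (simp add: network_def)
  next
    case False
    then have "n * r \<le> 3 * 3"
      using nr by (intro mult_mono) auto
    \<comment> \<open>With \<open>n * r\<close> at most \<open>9\<close>, a single bit already meets
      the bound.\<close>
    then have small: "n * r \<le> 50 * 1" by simp
    obtain swap where "\<forall>D. dual_ft_min_cut_oracle query D (bundle_digraph n r swap)
        (of_bool swap) (of_bool (\<not> swap)) \<longrightarrow> 1 \<le> length D"
      using bundle_digraph_oracle_space nr by blast
    then show ?thesis
      using n_vertex_digraph_bundle_digraph[of n r swap] has_max_flow_value_bundle_digraph[of n r swap]
        nr False bound[OF small]
      by (intro exI[of _ "bundle_digraph n r swap"] exI[of _ "of_bool swap"] exI[of _ "of_bool (\<not> swap)"])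
        (auto simp: bundle_digraph_def)
  qed
qed simp

end
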